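(* Let $p$ be an odd prime, $q\in\mathbb{C}_p$ with $|q-1|_p<1$, $\chi$ a Dirichlet character of odd conductor $d$ with $(d,p)=1$, $\zeta\in\mathcal{T}_p$, and $n\in\mathbb{N}\cup\{0\}$. Then $$I_{-q^{-1}}\left(\zeta^{x}\chi(x)x^{n}\right)=\int_{X}\zeta^{x}\chi(x)x^{n}\,d\mu_{-q^{-1}}(x)=\frac{(-1)^{n}}{(1+q)^{n}}\mathcal{A}_{n,\chi,\zeta}(-q).$$
   Context: $\mathbb{C}_p$ is the completion of an algebraic closure of $\mathbb{Q}_p$, $|p|_p=1/p$. $\mathcal{T}_p=\bigcup_{n\ge0}\{\zeta:\zeta^{p^n}=1\}$ is the set of all $p$-power roots of unity. $X=\varprojlim_N \mathbb{Z}/dp^N\mathbb{Z}$ (functions on $\mathbb{Z}_p$ are viewed as functions on $X$ via the natural projection). For $x$ an integer put $[x]_{-q}=\frac{1-(-q)^x}{1+q}$. The $p$-adic fermionic $q$-integral with parameter $q^{-1}$ is $$I_{-q^{-1}}(f)=\int_X f(x)\,d\mu_{-q^{-1}}(x)=\lim_{N\to\infty}\frac{1}{[dp^N]_{-q^{-1}}}\sum_{x=0}^{dp^N-1}(-1)^x q^{-x}f(x),$$ where $[m]_{-q^{-1}}=\frac{1-(-q^{-1})^m}{1+q^{-1}}$. With $[2]_q=1+q$, the Dirichlet-type twisted Eulerian polynomials $\mathcal{A}_{n,\chi,\zeta}(-q)$ are defined by the generating function $$\sum_{n=0}^{\infty}\mathcal{A}_{n,\chi,\zeta}(-q)\frac{t^n}{n!}=[2]_q\sum_{l=0}^{d-1}(-1)^l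 q^{d-l+1}\zeta^l\chi(l)\frac{e^{-l(1+q)t}}{\zeta^d e^{-d(1+q)t}+q^d}.$$
   Formalization: The exponent of q in the generating function of the twisted Eulerian polynomials is corrected from d-l+1 to d-l-1; as printed the formula is off by a factor q^2 (for d=1, trivial χ, ζ=1, n=0 it would say 1=q^2). *)

theory Defs
  imports Complex_Main
    "HOL-Computational_Algebra.Polynomial"
    "HOL-Computational_Algebra.Formal_Power_Series"
    "HOL-Number_Theory.Cong"
begin

definition vtendsto :: "('a::field \<Rightarrow> real) \<Rightarrow> (nat \<Rightarrow> 'a) \<Rightarrow> 'a \<Rightarrow> bool" where
  "vtendsto v s L \<longleftrightarrow> (\<lambda>N. v (s N - L)) \<longlonglongrightarrow> 0"

definition vCauchy :: "('a::field \<Rightarrow> real) \<Rightarrow> (nat \<Rightarrow> 'a) \<Rightarrow> bool" where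
  "vCauchy v s \<longleftrightarrow> (\<forall>e>0. \<exists>M. \<forall>m\<ge>M. \<forall>n\<ge>M. v (s m - s n) < e)"

text \<open>
  Inside a complete field with absolute value \<open>v\<close>, the closure of the rationals is their
  completion; for \<open>v\<close> normalised by \<open>v p = 1 / p\<close> this is \<open>\<rat>\<^sub>p\<close>.
\<close>

definition padic_rationals :: "('a::field_char_0 \<Rightarrow> real) \<Rightarrow> 'a set" where
  "padic_rationals v = {x. \<exists>s :: nat \<Rightarrow> rat. vtendsto v (\<lambda>n. of_rat (s n)) x}"

definition padic_algebraics :: "('a::field_char_0 \<Rightarrow> real) \<Rightarrow> 'a set" where
  "padic_algebraics v =
     {x. \<exists>P. P \<noteq> 0 \<and> (\<forall>i. coeff P i \<in> padic_rationals v) \<and> poly P x = 0}"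

text \<open>
  \<open>padic_complex p v\<close>: the type \<open>'a\<close> with absolute value \<open>v\<close> is a completion of an algebraic
  closure of \<open>\<rat>\<^sub>p\<close>, i.e. it is complete and has a dense subfield that is algebraic over \<open>\<rat>\<^sub>p\<close> and
  algebraically closed. This determines the field and \<open>v\<close> up to isometric isomorphism.
\<close>

locale padic_complex =
  fixes p :: nat and v :: "'a::field_char_0 \<Rightarrow> real"
  assumes prime_p: "prime p"
    and v_nonneg: "v x \<ge> 0"
    and v_eq_0_iff: "v x = 0 \<longleftrightarrow> x = 0"
    and v_mult: "v (x * y) = v x * v y"
    and v_ultrametric: "v (x + y) \<le> max (v x) (v y)"
    and v_p: "v (of_nat p) = 1 / real p"
    and complete: "vCauchy v s \<Longrightarrow> \<exists>L. vtendsto v s L"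
    and alg_closed: "degree P > 0 \<Longrightarrow> (\<And>i. coeff P i \<in> padic_algebraics v) \<Longrightarrow>
                       \<exists>z \<in> padic_algebraics v. poly P z = 0"
    and dense: "e > 0 \<Longrightarrow> \<exists>y \<in> padic_algebraics v. v (x - y) < e"

definition p_power_roots_of_unity :: "nat \<Rightarrow> 'a::field set" where
  "p_power_roots_of_unity p = (\<Union>n. {\<zeta>. \<zeta> ^ (p ^ n) = 1})"

definition dirichlet_char :: "nat \<Rightarrow> (int \<Rightarrow> 'a::field) \<Rightarrow> bool" where
  "dirichlet_char m \<chi> \<longleftrightarrow>
     m > 0 \<and> \<chi> 1 = 1 \<and> (\<forall>a b. \<chi> (a * b) = \<chi> a * \<chi> b) \<and>
     (\<forall>a. \<chi> (a + int m) = \<chi> a) \<and> (\<forall>a. \<chi> a = 0 \<longleftrightarrow> \<not> coprime a (int m))"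

definition induced_modulus :: "nat \<Rightarrow> (int \<Rightarrow> 'a::field) \<Rightarrow> nat \<Rightarrow> bool" where
  "induced_modulus m \<chi> k \<longleftrightarrow>
     k > 0 \<and> k dvd m \<and> (\<forall>a. coprime a (int m) \<and> [a = 1] (mod int k) \<longrightarrow> \<chi> a = 1)"

definition dirichlet_conductor :: "nat \<Rightarrow> (int \<Rightarrow> 'a::field) \<Rightarrow> nat" where
  "dirichlet_conductor m \<chi> = (LEAST k. induced_modulus m \<chi> k)"

text \<open>\<open>qbracket_neg q x\<close> is \<open>[x]\<close> with subscript \<open>-q\<close>.\<close>

definition qbracket_neg :: "'a::field \<Rightarrow> int \<Rightarrow> 'a" where
  "qbracket_neg q x = (1 - (-q) powi x) / (1 + q)"

text \<open>
  The Riemann sums of the fermionic integral over \<open>X\<close> with parameter \<open>1/q\<close>. They only involve the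
  values of the integrand at the non-negative integers, which are dense in \<open>X\<close>.
\<close>

definition fermionic_sum :: "nat \<Rightarrow> nat \<Rightarrow> 'a::field \<Rightarrow> (nat \<Rightarrow> 'a) \<Rightarrow> nat \<Rightarrow> 'a" where
  "fermionic_sum p d q f N =
     1 / qbracket_neg (inverse q) (int (d * p ^ N)) *
       (\<Sum>x<d * p ^ N. (-1) ^ x * q powi (- int x) * f x)"

definition fermionic_integrable ::
    "('a::field \<Rightarrow> real) \<Rightarrow> nat \<Rightarrow> nat \<Rightarrow> 'a \<Rightarrow> (nat \<Rightarrow> 'a) \<Rightarrow> bool" where
  "fermionic_integrable v p d q f \<longleftrightarrow> (\<exists>L. vtendsto v (fermionic_sum p d q f) L)"

definition fermionic_integral ::
    "('a::field \<Rightarrow> real) \<Rightarrow> nat \<Rightarrow> nat \<Rightarrow> 'a \<Rightarrow> (nat \<Rightarrow> 'a) \<Rightarrow> 'a" where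
  "fermionic_integral v p d q f = (THE L. vtendsto v (fermionic_sum p d q f) L)"

text \<open>
  The exponent of \<open>q\<close> is \<open>d - l - 1\<close>. The source prints \<open>d - l + 1\<close>, which is a misprint: for
  \<open>d = 1\<close>, \<open>\<zeta> = 1\<close> and trivial \<open>\<chi>\<close> only \<open>d - l - 1\<close> gives the Eulerian generating function
  \<open>(1 + q) / (exp (-(1 + q) t) + q)\<close>, and with \<open>d - l + 1\<close> the right-hand side of the integral
  formula would be off by the factor \<open>q\<^sup>2\<close> (already \<open>1 = q\<^sup>2\<close> for \<open>n = 0\<close>).
\<close>

definition twisted_eulerian_gf :: "nat \<Rightarrow> (int \<Rightarrow> 'a::field_char_0) \<Rightarrow> 'a \<Rightarrow> 'a \<Rightarrow> 'a fps" where
  "twisted_eulerian_gf d \<chi> \<zeta> q =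
     fps_const (1 + q) *
       (\<Sum>l<d. fps_const ((-1) ^ l * q ^ (d - l - 1) * \<zeta> ^ l * \<chi> (int l)) *
          (fps_exp (- of_nat l * (1 + q)) /
            (fps_const (\<zeta> ^ d) * fps_exp (- of_nat d * (1 + q)) + fps_const (q ^ d))))"

definition twisted_eulerian :: "nat \<Rightarrow> nat \<Rightarrow> (int \<Rightarrow> 'a::field_char_0) \<Rightarrow> 'a \<Rightarrow> 'a \<Rightarrow> 'a" where
  "twisted_eulerian n d \<chi> \<zeta> q = fact n * fps_nth (twisted_eulerian_gf d \<chi> \<zeta> q) n"

end

theory Submission imports Defs begin

text \<open>
  Put \<open>u = -\<zeta>/q\<close>, \<open>a = -(1 + q)\<close> and \<open>U(t) = u e\<^bsup>at\<^esup>\<close>. Since \<open>\<chi>\<close> has period \<open>d\<close>, the formal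
  series \<open>G(t) = \<Sum>\<^bsub>x\<ge>0\<^esub> \<chi>(x) U(t)\<^sup>x\<close> is the quotient of \<open>\<Sum>\<^bsub>l<d\<^esub> \<chi>(l) U(t)\<^sup>l\<close> by \<open>1 - U(t)\<^sup>d\<close>, and
  \<open>(1 + 1/q) G\<close> is the generating function of the twisted Eulerian polynomials. The partial sum
  over \<open>x < M = d p\<^sup>N\<close> is \<open>G(t) (1 - U(t)\<^sup>M)\<close>, whose coefficients approach those of
  \<open>(1 - u\<^sup>M) G(t)\<close> because \<open>M\<close> tends to \<open>0\<close> \<open>p\<close>-adically. Once \<open>\<zeta>\<^sup>M = 1\<close>, the \<open>N\<close>-th Riemann
  sum of \<open>\<zeta>\<^sup>x \<chi>(x) e\<^bsup>axt\<^esup>\<close> is \<open>(1 + 1/q) / (1 - u\<^sup>M)\<close> times this partial sum. The denominator is then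
  \<open>1 + 1/q\<^sup>M\<close>, which lies within distance less than \<open>1\<close> of \<open>2\<close> because \<open>q\<close> is a one-unit, so it
  has absolute value \<open>1\<close> because \<open>p\<close> is odd.
\<close>

lemma sum_periodic_power:
  fixes U :: "'b::comm_ring_1"
  assumes period: "\<And>x. c (x + d) = c x"
  shows "(\<Sum>x<d * m. c x * U ^ x) * (1 - U ^ d) = (\<Sum>l<d. c l * U ^ l) * (1 - U ^ (d * m))"
proof -
  have period_mult: "c (l + d * j) = c l" for l j
  proof (induction j)
    case (Suc j)
    then show ?case using period[of "l + d * j"] by (simp add: algebra_simps)
  qed simp
  have block: "(\<Sum>x = j * d..<j * d + d. c x * U ^ x) = (\<Sum>l<d. c l * U ^ l) * (U ^ d) ^ j" for j
  proof -
    have "(\<Sum>x = j * d..<j * d + d. c x * U ^ x) = (\<Sum>l<d. c (l + j * d) * U ^ (l + j * d))"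
      using sum.shift_bounds_nat_ivl[of "\<lambda>x. c x * U ^ x" 0 "j * d" d]
      by (simp add: lessThan_atLeast0 add.commute)
    also have "\<dots> = (\<Sum>l<d. c l * U ^ l) * (U ^ d) ^ j"
      by (simp add: period_mult sum_distrib_right power_add power_mult mult.assoc
            mult.commute[of j])
    finally show ?thesis .
  qed
  have "(\<Sum>x<d * m. c x * U ^ x) = (\<Sum>j<m. \<Sum>x = j * d..<j * d + d. c x * U ^ x)"
    by (simp add: sum.nat_group mult.commute)
  also have "\<dots> = (\<Sum>l<d. c l * U ^ l) * (\<Sum>j<m. (U ^ d) ^ j)"
    by (simp only: block sum_distrib_left)
  finally show ?thesis
    by (simp add: power_mult one_diff_power_eq[of "U ^ d" m] mult_ac)
qed

text \<open>The formal value of \<open>\<Sum>\<^bsub>x\<ge>0\<^esub> c(x) U\<^sup>x\<close> when \<open>c\<close> has period \<open>d\<close>.\<close>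

definition periodic_fps_sum :: "nat \<Rightarrow> (nat \<Rightarrow> 'a::field) \<Rightarrow> 'a fps \<Rightarrow> 'a fps" where
  "periodic_fps_sum d c U = (\<Sum>l<d. fps_const (c l) * U ^ l) / (1 - U ^ d)"

lemma sum_periodic_fps_power:
  assumes "\<And>x. c (x + d) = c x" and "fps_nth U 0 ^ d \<noteq> 1"
  shows "(\<Sum>x<d * m. fps_const (c x) * U ^ x) = periodic_fps_sum d c U * (1 - U ^ (d * m))"
proof -
  have unit: "fps_nth (1 - U ^ d) 0 \<noteq> 0"
    using assms(2) by (simp add: fps_nth_power_0)
  then have "1 - U ^ d \<noteq> 0" by auto
  moreover have "periodic_fps_sum d c U * (1 - U ^ d) = (\<Sum>l<d. fps_const (c l) * U ^ l)"
    using unit by (simp add: periodic_fps_sum_def fps_divide_unit mult.assoc inverse_mult_eq_1)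
  then have "(\<Sum>x<d * m. fps_const (c x) * U ^ x) * (1 - U ^ d)
      = periodic_fps_sum d c U * (1 - U ^ (d * m)) * (1 - U ^ d)"
    using sum_periodic_power[of "\<lambda>x. fps_const (c x)" d U m] assms(1) by (simp add: mult_ac)
  ultimately show ?thesis by simp
qed

lemma fps_const_mult_exp_power:
  "(fps_const u * fps_exp a) ^ k = fps_const (u ^ k) * fps_exp (of_nat k * a :: 'a::field_char_0)"
  by (simp add: power_mult_distrib fps_const_power fps_exp_power_mult)

lemma sum_periodic_power_mult_power:
  fixes c :: "nat \<Rightarrow> 'a::field_char_0" and u a :: 'a and d :: nat
  defines "G \<equiv> periodic_fps_sum d c (fps_const u * fps_exp a)"
  assumes "\<And>x. c (x + d) = c x" and "u ^ d \<noteq> 1"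
  shows "(\<Sum>x<d * m. c x * u ^ x * (of_nat x * a) ^ n) =
           fact n * (fps_nth G n - u ^ (d * m) * fps_nth (fps_exp (of_nat (d * m) * a) * G) n)"
proof -
  have "(\<Sum>x<d * m. c x * u ^ x * (of_nat x * a) ^ n) =
      fact n * fps_nth (\<Sum>x<d * m. fps_const (c x) * (fps_const u * fps_exp a) ^ x) n"
    by (simp add: fps_sum_nth fps_const_mult_exp_power sum_distrib_left mult.assoc)
  also have "(\<Sum>x<d * m. fps_const (c x) * (fps_const u * fps_exp a) ^ x) =
      G * (1 - (fps_const u * fps_exp a) ^ (d * m))"
    unfolding G_def using assms by (intro sum_periodic_fps_power) auto
  also have "\<dots> = G - fps_const (u ^ (d * m)) * (fps_exp (of_nat (d * m) * a) * G)"
    unfolding fps_const_mult_exp_power by (simp add: algebra_simps)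
  finally show ?thesis by simp
qed

lemma twisted_eulerian_gf_summand_eq:
  fixes q \<zeta> c :: "'a::field" and D F :: "'a fps"
  assumes "q \<noteq> 0" and "l < d" and "fps_nth D 0 \<noteq> 0"
  shows "fps_const (1 + q) *
           (fps_const ((-1) ^ l * q ^ (d - l - 1) * \<zeta> ^ l * c) * (F / (fps_const (q ^ d) * D))) =
         fps_const (1 + inverse q) * (fps_const c * (fps_const ((- \<zeta> / q) ^ l) * F) / D)"
proof -
  have "q ^ d = q * q ^ (d - l - 1) * q ^ l"
    using \<open>l < d\<close> by (simp flip: power_add power_Suc)
  then have coeff: "(1 + q) * ((-1) ^ l * q ^ (d - l - 1) * \<zeta> ^ l * c) * inverse (q ^ d) =
      (1 + inverse q) * (c * (- \<zeta> / q) ^ l)"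
    unfolding power_divide power_minus[of \<zeta>] using \<open>q \<noteq> 0\<close> by (simp add: field_simps)
  have quotient: "F / (fps_const (q ^ d) * D) = fps_const (inverse (q ^ d)) * (F * inverse D)"
    using \<open>q \<noteq> 0\<close> assms(3)
    by (simp add: fps_divide_unit fps_inverse_mult fps_const_inverse mult_ac)
  have "fps_const (1 + q) * (fps_const ((-1) ^ l * q ^ (d - l - 1) * \<zeta> ^ l * c) *
      (F / (fps_const (q ^ d) * D))) =
      fps_const ((1 + q) * ((-1) ^ l * q ^ (d - l - 1) * \<zeta> ^ l * c) * inverse (q ^ d)) *
        (F * inverse D)"
    unfolding quotient by (simp only: mult.assoc flip: fps_const_mult)
  also have "\<dots> = fps_const (1 + inverse q) * (fps_const c * (fps_const ((- \<zeta> / q) ^ l) * F) / D)"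
    unfolding coeff fps_divide_unit[OF assms(3)] by (simp only: mult.assoc flip: fps_const_mult)
  finally show ?thesis .
qed

lemma twisted_eulerian_gf_eq_periodic_fps_sum:
  fixes q \<zeta> :: "'a::field_char_0"
  assumes "q \<noteq> 0" and "odd d" and unit: "(- \<zeta> / q) ^ d \<noteq> 1"
  shows "twisted_eulerian_gf d \<chi> \<zeta> q =
           fps_const (1 + inverse q) *
             periodic_fps_sum d (\<lambda>l. \<chi> (int l)) (fps_const (- \<zeta> / q) * fps_exp (- (1 + q)))"
proof -
  define U where "U = fps_const (- \<zeta> / q) * fps_exp (- (1 + q))"
  have U_power: "U ^ k = fps_const ((- \<zeta> / q) ^ k) * fps_exp (- of_nat k * (1 + q))" for k
    by (simp only: U_def fps_const_mult_exp_power mult_minus_left mult_minus_right)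
  have U_unit: "fps_nth (1 - U ^ d) 0 \<noteq> 0"
    using unit by (simp add: U_power)
  have denominator: "fps_const (\<zeta> ^ d) * fps_exp (- of_nat d * (1 + q)) + fps_const (q ^ d) =
      fps_const (q ^ d) * (1 - U ^ d)"
    unfolding U_power using assms(1,2)
    by (simp add: distrib_left right_diff_distrib power_divide flip: mult.assoc fps_const_neg)
  have "twisted_eulerian_gf d \<chi> \<zeta> q =
      (\<Sum>l<d. fps_const (1 + inverse q) * (fps_const (\<chi> (int l)) * U ^ l / (1 - U ^ d)))"
    unfolding twisted_eulerian_gf_def denominator sum_distrib_left U_power
    by (intro sum.cong refl twisted_eulerian_gf_summand_eq)
      (use \<open>q \<noteq> 0\<close> U_unit in \<open>auto simp: U_power\<close>)
  also have "\<dots> = fps_const (1 + inverse q) * periodic_fps_sum d (\<lambda>l. \<chi> (int l)) U"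
    using U_unit by (simp add: periodic_fps_sum_def fps_divide_unit sum_distrib_left
        sum_distrib_right)
  finally show ?thesis by (simp only: U_def)
qed

lemma fermionic_sum_eq:
  "fermionic_sum p d q f N =
     (1 + inverse q) * ((\<Sum>x<d * p ^ N. (- inverse q) ^ x * f x) / (1 - (- inverse q) ^ (d * p ^ N)))"
proof -
  have "(-1) ^ x * q powi (- int x) = (- inverse q) ^ x" for x
    using power_minus[of "inverse q" x] by (simp add: power_int_minus power_inverse)
  then show ?thesis
    by (simp add: fermionic_sum_def qbracket_neg_def power_int_of_nat del: of_nat_mult of_nat_power)
qed

lemma fermionic_sum_twisted:
  assumes "\<zeta> ^ (d * p ^ N) = 1"
  shows "fermionic_sum p d q (\<lambda>x. \<zeta> ^ x * f x) N =
           (1 + inverse q) *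
             ((\<Sum>x<d * p ^ N. (- \<zeta> / q) ^ x * f x) / (1 - (- \<zeta> / q) ^ (d * p ^ N)))"
proof -
  have "(- \<zeta> / q) ^ x = (- inverse q) ^ x * \<zeta> ^ x" for x
    by (simp add: divide_inverse mult.commute flip: power_mult_distrib)
  then show ?thesis by (simp add: fermionic_sum_eq assms mult.assoc)
qed

lemma fermionic_sum_twisted_mult_power:
  assumes "\<zeta> ^ (d * p ^ N) = 1" and "a \<noteq> 0"
  shows "fermionic_sum p d q (\<lambda>x. \<zeta> ^ x * c x * of_nat x ^ n) N =
           (1 + inverse q) / a ^ n *
             ((\<Sum>x<d * p ^ N. c x * (- \<zeta> / q) ^ x * (of_nat x * a) ^ n) /
              (1 - (- \<zeta> / q) ^ (d * p ^ N)))"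
proof -
  have "(\<Sum>x<d * p ^ N. c x * (- \<zeta> / q) ^ x * (of_nat x * a) ^ n) =
      a ^ n * (\<Sum>x<d * p ^ N. (- \<zeta> / q) ^ x * (c x * of_nat x ^ n))"
    by (simp add: power_mult_distrib sum_distrib_left mult_ac)
  then show ?thesis
    using fermionic_sum_twisted[OF assms(1), of q "\<lambda>x. c x * of_nat x ^ n"] \<open>a \<noteq> 0\<close>
    by (simp add: mult.assoc)
qed

lemma eventually_p_power_root_of_unity_power_eq_1:
  assumes "\<zeta> \<in> p_power_roots_of_unity p"
  shows "\<forall>\<^sub>F N in sequentially. \<zeta> ^ (d * p ^ N) = 1"
proof -
  obtain k where k: "\<zeta> ^ (p ^ k) = 1"
    using assms by (auto simp: p_power_roots_of_unity_def)
  show ?thesis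
    using eventually_ge_at_top[of k]
  proof eventually_elim
    case (elim N)
    then have "d * p ^ N = p ^ k * (d * p ^ (N - k))"
      by (simp flip: power_add)
    then show ?case using k by (simp only: power_mult power_one)
  qed
qed

locale nonarchimedean_abs =
  fixes v :: "'a::field \<Rightarrow> real"
  assumes v_nonneg: "v x \<ge> 0"
    and v_eq_0_iff: "v x = 0 \<longleftrightarrow> x = 0"
    and v_mult: "v (x * y) = v x * v y"
    and v_ultrametric: "v (x + y) \<le> max (v x) (v y)"
begin

lemma v_0 [simp]: "v 0 = 0"
  by (simp add: v_eq_0_iff)

lemma v_1 [simp]: "v 1 = 1"
  using v_mult[of 1 1] v_eq_0_iff[of 1] by simp

lemma v_minus [simp]: "v (- x) = v x"
proof -
  have "v (-1) * v (-1) = 1" using v_mult[of "-1" "-1"] by simp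
  then have "v (-1) = 1" using v_nonneg[of "-1"] by (simp add: square_eq_1_iff)
  then show ?thesis using v_mult[of "-1" x] by simp
qed

lemma v_minus_commute: "v (x - y) = v (y - x)"
  using v_minus[of "x - y"] by simp

lemma v_power: "v (x ^ n) = v x ^ n"
  by (induction n) (simp_all add: v_mult)

lemma v_inverse: "v (inverse x) = inverse (v x)"
proof (cases "x = 0")
  case False
  then have "v x * v (inverse x) = 1" by (simp flip: v_mult)
  then show ?thesis by (metis inverse_unique)
qed simp

lemma v_triangle: "v (x + y) \<le> v x + v y"
  using v_ultrametric[of x y] v_nonneg[of x] v_nonneg[of y] by linarith

lemma v_of_nat_le_1: "v (of_nat n) \<le> 1"
proof (induction n)
  case (Suc n)
  then show ?case using v_ultrametric[of 1 "of_nat n"] by simp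
qed simp

lemma v_add_eq_left:
  assumes "v y < v x"
  shows "v (x + y) = v x"
proof (rule antisym)
  show "v (x + y) \<le> v x" using v_ultrametric[of x y] assms by simp
  show "v x \<le> v (x + y)" using v_ultrametric[of "x + y" "- y"] assms by simp
qed

definition one_unit :: "'a \<Rightarrow> bool" where
  "one_unit x \<longleftrightarrow> v (x - 1) < 1"

lemma v_one_unit:
  assumes "one_unit x"
  shows "v x = 1"
  using v_add_eq_left[of "x - 1" 1] assms by (simp add: one_unit_def)

lemma one_unit_mult:
  assumes "one_unit x" "one_unit y"
  shows "one_unit (x * y)"
proof -
  have "x * y - 1 = (x - 1) * y + (y - 1)" by (simp add: algebra_simps)
  then have "v (x * y - 1) \<le> max (v (x - 1) * v y) (v (y - 1))"
    by (metis v_mult v_ultrametric)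
  then show ?thesis using assms v_one_unit[OF assms(2)] by (simp add: one_unit_def)
qed

lemma one_unit_power: "one_unit x \<Longrightarrow> one_unit (x ^ n)"
  by (induction n) (simp_all add: one_unit_mult, simp add: one_unit_def)

lemma one_unit_inverse:
  assumes "one_unit x"
  shows "one_unit (inverse x)"
proof -
  have "x \<noteq> 0" using v_one_unit[OF assms] by auto
  then have "inverse x - 1 = inverse x * (1 - x)" by (simp add: algebra_simps)
  then have "v (inverse x - 1) = v (1 - x)"
    by (simp add: v_mult v_inverse v_one_unit[OF assms])
  then show ?thesis using assms v_minus_commute[of x 1] by (simp add: one_unit_def)
qed

lemma vtendsto_cong:
  assumes "\<forall>\<^sub>F N in sequentially. s N = t N"
  shows "vtendsto v s L \<longleftrightarrow> vtendsto v t L"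
  unfolding vtendsto_def by (rule tendsto_cong) (use assms in \<open>auto elim: eventually_mono\<close>)

lemma vtendsto_unique:
  assumes "vtendsto v s L" "vtendsto v s L'"
  shows "L = L'"
proof -
  have "(\<lambda>N. v (s N - L) + v (s N - L')) \<longlonglongrightarrow> 0 + 0"
    using assms unfolding vtendsto_def by (intro tendsto_add)
  moreover have "v (L' - L) \<le> v (s N - L) + v (s N - L')" for N
    using v_triangle[of "s N - L" "L' - s N"] v_minus_commute[of "s N" L'] by simp
  ultimately have "v (L' - L) \<le> 0"
    by (intro tendsto_lowerbound[of _ 0 sequentially]) auto
  then show ?thesis using v_nonneg[of "L' - L"] v_eq_0_iff[of "L' - L"] by simp
qed

lemma vtendsto_const: "vtendsto v (\<lambda>N. L) L"
  by (simp add: vtendsto_def)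

lemma vtendstoI_bound:
  assumes "\<forall>\<^sub>F N in sequentially. v (s N - L) \<le> g N" and "g \<longlonglongrightarrow> 0"
  shows "vtendsto v s L"
  unfolding vtendsto_def
  by (rule tendsto_sandwich[OF _ assms(1) tendsto_const assms(2)]) (simp add: v_nonneg)

lemma vtendsto_iff_diff_0: "vtendsto v s L \<longleftrightarrow> vtendsto v (\<lambda>N. L - s N) 0"
  by (simp add: vtendsto_def v_minus_commute)

lemma vtendsto_add:
  assumes "vtendsto v s L" "vtendsto v t K"
  shows "vtendsto v (\<lambda>N. s N + t N) (L + K)"
proof (rule vtendstoI_bound)
  show "\<forall>\<^sub>F N in sequentially. v (s N + t N - (L + K)) \<le> v (s N - L) + v (t N - K)"
    using v_triangle[of "s N - L" "t N - K" for N] by (simp add: algebra_simps)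
  show "(\<lambda>N. v (s N - L) + v (t N - K)) \<longlonglongrightarrow> 0"
    using tendsto_add[OF assms[unfolded vtendsto_def]] by simp
qed

lemma vtendsto_0_mult_bounded:
  assumes "vtendsto v s 0" and "\<forall>\<^sub>F N in sequentially. v (b N) \<le> B"
  shows "vtendsto v (\<lambda>N. s N * b N) 0"
proof (rule vtendstoI_bound)
  show "\<forall>\<^sub>F N in sequentially. v (s N * b N - 0) \<le> v (s N) * B"
    using assms(2) by eventually_elim (simp add: v_mult v_nonneg mult_left_mono)
  show "(\<lambda>N. v (s N) * B) \<longlonglongrightarrow> 0"
    using assms(1) by (auto simp: vtendsto_def intro: tendsto_mult_left_zero)
qed

lemma vtendsto_mult:
  assumes "vtendsto v s L" "vtendsto v t K"
  shows "vtendsto v (\<lambda>N. s N * t N) (L * K)"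
proof (rule vtendstoI_bound)
  show "\<forall>\<^sub>F N in sequentially. v (s N * t N - L * K) \<le>
      v (s N - L) * v (t N - K) + (v L * v (t N - K) + v (s N - L) * v K)"
  proof (intro always_eventually allI)
    fix N
    have "s N * t N - L * K = (s N - L) * (t N - K) + (L * (t N - K) + (s N - L) * K)"
      by (simp add: algebra_simps)
    then show "v (s N * t N - L * K) \<le>
        v (s N - L) * v (t N - K) + (v L * v (t N - K) + v (s N - L) * v K)"
      using v_triangle[of "(s N - L) * (t N - K)" "L * (t N - K) + (s N - L) * K"]
        v_triangle[of "L * (t N - K)" "(s N - L) * K"] by (simp add: v_mult)
  qed
  have "(\<lambda>N. v (s N - L) * v (t N - K) + (v L * v (t N - K) + v (s N - L) * v K))
      \<longlonglongrightarrow> 0 * 0 + (v L * 0 + 0 * v K)"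
    using assms unfolding vtendsto_def by (intro tendsto_intros)
  then show "(\<lambda>N. v (s N - L) * v (t N - K) + (v L * v (t N - K) + v (s N - L) * v K)) \<longlonglongrightarrow> 0"
    by simp
qed

lemma vtendsto_poly:
  assumes "vtendsto v s L"
  shows "vtendsto v (\<lambda>N. poly P (s N)) (poly P L)"
  by (induction P) (simp_all add: vtendsto_const vtendsto_add vtendsto_mult assms)

lemma fermionic_integral_eqI:
  assumes "vtendsto v (fermionic_sum p d q f) L"
  shows "fermionic_integral v p d q f = L"
  unfolding fermionic_integral_def using assms by (blast intro: vtendsto_unique)

end

lemma fps_nth_exp_mult_eq_poly:
  fixes G :: "'a::field_char_0 fps"
  obtains P where "\<And>x. fps_nth (fps_exp x * G) n = poly P x"
proof
  show "fps_nth (fps_exp x * G) n =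
      poly (\<Sum>k = 0..n. monom (fps_nth G (n - k) / fact k) k) x" for x
    unfolding fps_mult_nth by (simp add: poly_sum poly_monom mult.commute)
qed

locale nonarchimedean_abs_char_0 = nonarchimedean_abs v for v :: "'a::field_char_0 \<Rightarrow> real"
begin

lemma vtendsto_fps_nth_exp_mult:
  assumes "vtendsto v s 0"
  shows "vtendsto v (\<lambda>N. fps_nth (fps_exp (s N) * G) n) (fps_nth G n)"
proof -
  obtain P where P: "\<And>x. fps_nth (fps_exp x * G) n = poly P x"
    using fps_nth_exp_mult_eq_poly[of G n] by blast
  have "poly P 0 = fps_nth G n" using P[of 0] by simp
  then show ?thesis using vtendsto_poly[OF assms, of P] by (simp add: P)
qed

lemma vtendsto_sum_periodic_power_mult_power:
  fixes u a :: 'a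
  assumes "\<And>x. c (x + d) = c x" and "u ^ d \<noteq> 1"
    and small: "vtendsto v (\<lambda>N. of_nat (d * m N)) 0"
    and "\<delta> > 0" and away: "\<forall>\<^sub>F N in sequentially. \<delta> \<le> v (1 - u ^ (d * m N))"
  shows "vtendsto v
           (\<lambda>N. (\<Sum>x<d * m N. c x * u ^ x * (of_nat x * a) ^ n) / (1 - u ^ (d * m N)))
           (fact n * fps_nth (periodic_fps_sum d c (fps_const u * fps_exp a)) n)"
proof -
  define G where "G = periodic_fps_sum d c (fps_const u * fps_exp a)"
  define b where "b N = 1 - u ^ (d * m N)" for N
  define E where "E N = fps_nth (fps_exp (of_nat (d * m N) * a) * G) n" for N
  have "vtendsto v (\<lambda>N. of_nat (d * m N) * a) 0"
    using vtendsto_mult[OF small vtendsto_const[of a]] by simp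
  then have "vtendsto v E (fps_nth G n)"
    unfolding E_def by (rule vtendsto_fps_nth_exp_mult)
  moreover have "\<forall>\<^sub>F N in sequentially. v (inverse (b N)) \<le> inverse \<delta>"
    using away by eventually_elim (use \<open>\<delta> > 0\<close> in \<open>simp add: b_def v_inverse le_imp_inverse_le\<close>)
  ultimately have "vtendsto v (\<lambda>N. E N + (fps_nth G n - E N) * inverse (b N)) (fps_nth G n + 0)"
    by (intro vtendsto_add vtendsto_0_mult_bounded) (simp_all flip: vtendsto_iff_diff_0)
  then have "vtendsto v (\<lambda>N. fact n * (E N + (fps_nth G n - E N) * inverse (b N)))
      (fact n * fps_nth G n)"
    using vtendsto_mult[OF vtendsto_const] by simp
  moreover have "\<forall>\<^sub>F N in sequentially.
      (\<Sum>x<d * m N. c x * u ^ x * (of_nat x * a) ^ n) / b N =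
      fact n * (E N + (fps_nth G n - E N) * inverse (b N))"
    using away
  proof eventually_elim
    case (elim N)
    then have "b N \<noteq> 0" using \<open>\<delta> > 0\<close> by (auto simp: b_def)
    moreover have "(\<Sum>x<d * m N. c x * u ^ x * (of_nat x * a) ^ n) =
        fact n * (fps_nth G n - (1 - b N) * E N)"
      unfolding G_def E_def b_def using sum_periodic_power_mult_power[of c d u] assms(1,2) by simp
    ultimately show ?case by (simp add: field_simps)
  qed
  ultimately show ?thesis by (simp add: vtendsto_cong b_def G_def)
qed

end

sublocale padic_complex \<subseteq> nonarchimedean_abs_char_0 v
  by unfold_locales (fact v_nonneg v_eq_0_iff v_mult v_ultrametric)+

context padic_complex
begin

lemma v_p_less_1: "v (of_nat p) < 1"
  using prime_gt_1_nat[OF prime_p] by (simp add: v_p)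

lemma v_of_nat_coprime:
  assumes "coprime m p"
  shows "v (of_nat m) = 1"
proof -
  obtain x where "[m * x = 1] (mod p)" using cong_solve_coprime_nat[OF assms] by auto
  then have "(m * x) mod p = 1" using prime_gt_1_nat[OF prime_p] by (simp add: cong_def)
  then obtain k where k: "m * x = 1 + p * k" by (metis add.commute mult_div_mod_eq)
  have "v (of_nat (p * k)) < v 1"
    using v_p_less_1 v_nonneg v_of_nat_le_1[of k]
    by (auto simp: v_mult intro: order.strict_trans1[OF mult_left_le])
  then have "v (of_nat (m * x)) = 1"
    unfolding k using v_add_eq_left[of "of_nat (p * k)" 1] by simp
  then have "v (of_nat m) * v (of_nat x) = 1" by (simp add: v_mult)
  then show ?thesis
    using v_of_nat_le_1[of m] v_of_nat_le_1[of x] v_nonneg[of "of_nat m"]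
      mult_left_le[of "v (of_nat x)" "v (of_nat m)"] by simp
qed

lemma v_1_plus_one_unit:
  assumes "odd p" and "one_unit x"
  shows "v (1 + x) = 1"
proof -
  have "v 2 = 1" using v_of_nat_coprime[of 2] \<open>odd p\<close> by simp
  then show ?thesis
    using v_add_eq_left[of "x - 1" 2] \<open>one_unit x\<close> by (simp add: one_unit_def)
qed

lemma vtendsto_of_nat_mult_p_power: "vtendsto v (\<lambda>N. of_nat (d * p ^ N)) 0"
proof -
  have "(\<lambda>N. v (of_nat d) * v (of_nat p) ^ N) \<longlonglongrightarrow> v (of_nat d) * 0"
    using v_p_less_1 v_nonneg by (intro tendsto_intros LIMSEQ_power_zero) simp
  then show ?thesis by (simp add: vtendsto_def v_mult v_power)
qed

lemma v_one_minus_minus_divide_power_eq_1: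
  assumes "odd p" and "one_unit q" and "odd M" and "\<zeta> ^ M = 1"
  shows "v (1 - (- \<zeta> / q) ^ M) = 1"
proof -
  have "1 - (- \<zeta> / q) ^ M = 1 + inverse q ^ M"
    using assms(3,4) by (simp add: power_divide power_inverse inverse_eq_divide)
  then show ?thesis
    using assms by (simp add: v_1_plus_one_unit one_unit_power one_unit_inverse)
qed

lemma vtendsto_fermionic_sum:
  assumes "odd p" and "one_unit q" and "odd d" and \<zeta>: "\<zeta> \<in> p_power_roots_of_unity p"
    and period: "\<And>x. \<chi> (x + int d) = \<chi> x"
  shows "vtendsto v (fermionic_sum p d q (\<lambda>x. \<zeta> ^ x * \<chi> (int x) * of_nat x ^ n))
           ((-1) ^ n / (1 + q) ^ n * twisted_eulerian n d \<chi> \<zeta> q)"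
proof -
  define u a where "u = - \<zeta> / q" and "a = - (1 + q)"
  define S where "S N = (\<Sum>x<d * p ^ N. \<chi> (int x) * u ^ x * (of_nat x * a) ^ n)" for N
  have "q \<noteq> 0" using v_one_unit[OF \<open>one_unit q\<close>] by auto
  have "v (1 + q) = 1" using assms(1,2) by (rule v_1_plus_one_unit)
  then have "1 + q \<noteq> 0" by auto
  then have "a \<noteq> 0" unfolding a_def neg_equal_0_iff_equal .
  have root: "\<forall>\<^sub>F N in sequentially. \<zeta> ^ (d * p ^ N) = 1"
    using \<zeta> by (rule eventually_p_power_root_of_unity_power_eq_1)
  then have away: "\<forall>\<^sub>F N in sequentially. v (1 - u ^ (d * p ^ N)) = 1"
    by eventually_elim (unfold u_def, rule v_one_minus_minus_divide_power_eq_1, use assms in auto)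
  then obtain N where "v (1 - u ^ (d * p ^ N)) = 1"
    using eventually_happens by force
  then have "u ^ d \<noteq> 1" by (auto simp: power_mult)
  define g where "g = fact n *
      fps_nth (periodic_fps_sum d (\<lambda>l. \<chi> (int l)) (fps_const u * fps_exp a)) n"
  have eulerian: "twisted_eulerian n d \<chi> \<zeta> q = (1 + inverse q) * g"
    using twisted_eulerian_gf_eq_periodic_fps_sum[OF \<open>q \<noteq> 0\<close> \<open>odd d\<close>, of \<zeta> \<chi>] \<open>u ^ d \<noteq> 1\<close>
    by (simp add: twisted_eulerian_def g_def u_def a_def)
  have "vtendsto v (\<lambda>N. S N / (1 - u ^ (d * p ^ N))) g"
    unfolding S_def g_def using period \<open>u ^ d \<noteq> 1\<close> away
    by (intro vtendsto_sum_periodic_power_mult_power[where \<delta> = 1] vtendsto_of_nat_mult_p_power)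
      (auto elim: eventually_mono)
  then have "vtendsto v (\<lambda>N. (1 + inverse q) / a ^ n * (S N / (1 - u ^ (d * p ^ N))))
      ((1 + inverse q) / a ^ n * g)"
    by (intro vtendsto_mult vtendsto_const)
  moreover have "\<forall>\<^sub>F N in sequentially.
      fermionic_sum p d q (\<lambda>x. \<zeta> ^ x * \<chi> (int x) * of_nat x ^ n) N =
      (1 + inverse q) / a ^ n * (S N / (1 - u ^ (d * p ^ N)))"
    using root unfolding S_def u_def
    by eventually_elim (rule fermionic_sum_twisted_mult_power[OF _ \<open>a \<noteq> 0\<close>])
  moreover have "(1 + inverse q) / a ^ n * g =
      (-1) ^ n / (1 + q) ^ n * twisted_eulerian n d \<chi> \<zeta> q"
    unfolding eulerian a_def power_minus[of "1 + q" n] by (cases "even n") simp_all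
  ultimately show ?thesis by (simp add: vtendsto_cong)
qed

end

theorem theorem1:
  fixes p d n :: nat
    and v :: "'a::field_char_0 \<Rightarrow> real"
    and q \<zeta> :: 'a
    and \<chi> :: "int \<Rightarrow> 'a"
  assumes "prime p" and "odd p"
    and "padic_complex p v"
    and "v (q - 1) < 1"
    and "dirichlet_char d \<chi>" and "dirichlet_conductor d \<chi> = d"
    and "odd d" and "coprime d p"
    and "\<zeta> \<in> p_power_roots_of_unity p"
  shows "fermionic_integrable v p d q (\<lambda>x. \<zeta> ^ x * \<chi> (int x) * of_nat x ^ n) \<and>
         fermionic_integral v p d q (\<lambda>x. \<zeta> ^ x * \<chi> (int x) * of_nat x ^ n) =
           (-1) ^ n / (1 + q) ^ n * twisted_eulerian n d \<chi> \<zeta> q"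
proof -
  interpret padic_complex p v by fact
  have "vtendsto v (fermionic_sum p d q (\<lambda>x. \<zeta> ^ x * \<chi> (int x) * of_nat x ^ n))
           ((-1) ^ n / (1 + q) ^ n * twisted_eulerian n d \<chi> \<zeta> q)"
    using assms by (intro vtendsto_fermionic_sum) (auto simp: dirichlet_char_def one_unit_def)
  then show ?thesis
    unfolding fermionic_integrable_def by (blast intro: fermionic_integral_eqI)
qed

end
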